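(* Let $\mathcal{W}$ be the class of graph maps $f:A\to B$ in the category $\mathcal{G}$ of finite graphs such that for every subgraph $T\subseteq A$ with $T\cong A_s$, the restriction $f|_T:T\to f(T)$ is an isomorphism and $f(T)\cong B_s$. Let $\mathcal{W}_{\mathrm{new}}$ be the smallest class of morphisms of $\mathcal{G}$ that contains $\mathcal{W}$ and satisfies the 2 out of 6 property. Then $\mathcal{W}_{\mathrm{new}}$ contains graph morphisms whose domain and codomain have non-isomorphic stiff subgraphs; that is, there is a morphism $f:A\to B$ in $\mathcal{W}_{\mathrm{new}}$ with $A_s\not\cong B_s$.
   Context: Graphs: $\mathcal{G}$ is the category of finite undirected graphs without multiple edges (loops are allowed). A morphism (graph map) is a function on vertices that sends edges to edges. For a graph map $f:A\to B$ and a subgraph $T\subseteq A$, $f(T)$ denotes the image subgraph of $B$ (vertices $f(V(T))$, edges the images of the edges of $T$). Folds and stiff graphs: $\mathrm{N}(v)$ is the set of neighbours of $v$ (containing $v$ iff $v$ is looped). A vertex $v$ of $G$ folds to a vertex $v'\neq v$ of $G$ if $\mathrm{N}(v)\subseteq \mathrm{N}(v')$; the graph map $G\to G-v$ sending $v$ to $v'$ and fixing all other vertices is then called a fold map. A graph is stiff if it has no folds. A stiff subgraph of $G$, denoted $G_s$, is a stiff subgraph that $G$ folds down to by a (possibly empty) sequence of folds; it is unique up to isomorphism. 2 out of 6 property of a class of morphisms: for any composable morphisms $f:A\to B$, $g:B\to C$, $h:C\to D$, if $gf$ and $hg$ are in the class, then so are $f,g,h$ and $hgf$. *)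

theory Defs
  imports
    "Graph_Theory.Pair_Digraph"
    "Graph_Theory.Digraph_Component"
    "HOL-Library.FuncSet"
begin

text \<open>
  A finite undirected graph without multiple edges, loops allowed, is a \<open>pair_pseudo_graph\<close>: a
  finite vertex set with a symmetric set of arcs, an edge \<open>uv\<close> being represented by the two arcs
  \<open>(u, v)\<close> and \<open>(v, u)\<close> (which coincide for a loop).
\<close>

text \<open>
  Graph maps are extensional functions (\<open>undefined\<close> outside the vertex set of the domain), so that
  a morphism \<open>A \<rightarrow> B\<close> of the category is exactly one HOL function; accordingly composition and
  restriction are \<^const>\<open>compose\<close> and \<^const>\<open>restrict\<close>.
\<close>

definition graph_map :: "'a pair_pre_digraph \<Rightarrow> 'b pair_pre_digraph \<Rightarrow> ('a \<Rightarrow> 'b) \<Rightarrow> bool" where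
  "graph_map A B f \<longleftrightarrow>
     pair_pseudo_graph A \<and> pair_pseudo_graph B \<and>
     f \<in> pverts A \<rightarrow>\<^sub>E pverts B \<and>
     (\<forall>u v. (u, v) \<in> parcs A \<longrightarrow> (f u, f v) \<in> parcs B)"

definition graph_isomorphism ::
    "'a pair_pre_digraph \<Rightarrow> 'b pair_pre_digraph \<Rightarrow> ('a \<Rightarrow> 'b) \<Rightarrow> bool" where
  "graph_isomorphism A B f \<longleftrightarrow>
     graph_map A B f \<and> bij_betw f (pverts A) (pverts B) \<and>
     (\<forall>u\<in>pverts A. \<forall>v\<in>pverts A. (f u, f v) \<in> parcs B \<longrightarrow> (u, v) \<in> parcs A)"

definition graph_isomorphic :: "'a pair_pre_digraph \<Rightarrow> 'b pair_pre_digraph \<Rightarrow> bool"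
    (infix \<open>\<cong>\<^sub>G\<close> 50) where
  "A \<cong>\<^sub>G B \<longleftrightarrow> (\<exists>f. graph_isomorphism A B f)"

text \<open>Subgraphs need not be induced.\<close>

definition undirected_subgraph :: "'a pair_pre_digraph \<Rightarrow> 'a pair_pre_digraph \<Rightarrow> bool" where
  "undirected_subgraph T A \<longleftrightarrow> pair_pseudo_graph T \<and> subgraph (with_proj T) (with_proj A)"

definition image_graph :: "('a \<Rightarrow> 'b) \<Rightarrow> 'a pair_pre_digraph \<Rightarrow> 'b pair_pre_digraph" where
  "image_graph f T = \<lparr>pverts = f ` pverts T, parcs = map_prod f f ` parcs T\<rparr>"

definition neighbours :: "'a pair_pre_digraph \<Rightarrow> 'a \<Rightarrow> 'a set" where
  "neighbours G v = {w. (v, w) \<in> parcs G}"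

definition folds_to :: "'a pair_pre_digraph \<Rightarrow> 'a \<Rightarrow> 'a \<Rightarrow> bool" where
  "folds_to G v v' \<longleftrightarrow>
     v \<in> pverts G \<and> v' \<in> pverts G \<and> v' \<noteq> v \<and> neighbours G v \<subseteq> neighbours G v'"

definition delete_vertex :: "'a pair_pre_digraph \<Rightarrow> 'a \<Rightarrow> 'a pair_pre_digraph" where
  "delete_vertex G v =
     \<lparr>pverts = pverts G - {v}, parcs = {e \<in> parcs G. fst e \<noteq> v \<and> snd e \<noteq> v}\<rparr>"

definition fold_step :: "'a pair_pre_digraph \<Rightarrow> 'a pair_pre_digraph \<Rightarrow> bool" where
  "fold_step G H \<longleftrightarrow> (\<exists>v v'. folds_to G v v' \<and> H = delete_vertex G v)"

definition stiff :: "'a pair_pre_digraph \<Rightarrow> bool" where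
  "stiff G \<longleftrightarrow> (\<nexists>v v'. folds_to G v v')"

definition stiff_subgraph_of :: "'a pair_pre_digraph \<Rightarrow> 'a pair_pre_digraph \<Rightarrow> bool" where
  "stiff_subgraph_of S G \<longleftrightarrow> fold_step\<^sup>*\<^sup>* G S \<and> stiff S"

text \<open>
  The graph \<open>G\<^sub>s\<close>. It exists by the lemma below and is unique only up to isomorphism, so one is
  chosen; it is used only up to \<open>\<cong>\<^sub>G\<close>.
\<close>

definition stiff_subgraph :: "'a pair_pre_digraph \<Rightarrow> 'a pair_pre_digraph" where
  "stiff_subgraph G = (SOME S. stiff_subgraph_of S G)"

lemma stiff_subgraph_of_stiff_subgraph:
  assumes "pair_pseudo_graph G"
  shows "stiff_subgraph_of (stiff_subgraph G) G"
proof -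
  have "\<exists>S. stiff_subgraph_of S G" if "finite (pverts G)" for G :: "'a pair_pre_digraph"
    using that
  proof (induction "card (pverts G)" arbitrary: G rule: less_induct)
    case less
    show ?case
    proof (cases "stiff G")
      case True
      then show ?thesis by (auto simp: stiff_subgraph_of_def)
    next
      case False
      then obtain v v' where v: "folds_to G v v'" by (auto simp: stiff_def)
      let ?H = "delete_vertex G v"
      have "card (pverts ?H) < card (pverts G)" "finite (pverts ?H)"
        using v less.prems
        by (simp_all add: folds_to_def delete_vertex_def card_Diff1_less del: card_Diff_insert)
      from less.hyps[OF this] obtain S where "stiff_subgraph_of S ?H" by blast
      moreover have "fold_step G ?H" using v by (auto simp: fold_step_def)
      ultimately show ?thesis
        by (meson stiff_subgraph_of_def converse_rtranclp_into_rtranclp)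
    qed
  qed
  moreover have "finite (pverts G)"
    using assms by (simp add: pair_pseudo_graph_def pair_fin_digraph.pair_finite_verts)
  ultimately show ?thesis unfolding stiff_subgraph_def by (metis someI_ex)
qed

text \<open>
  A morphism carries its domain and codomain. All graphs have vertices in one type \<open>'a\<close>; when \<open>'a\<close>
  is infinite, every finite graph is isomorphic to one of these, so they form a full subcategory of
  \<open>\<G>\<close> that is equivalent to \<open>\<G>\<close>.
\<close>

type_synonym 'a graph_morphism = "'a pair_pre_digraph \<times> 'a pair_pre_digraph \<times> ('a \<Rightarrow> 'a)"

definition graph_morphisms :: "'a graph_morphism set" where
  "graph_morphisms = {(A, B, f). graph_map A B f}"

definition W :: "'a graph_morphism set" where
  "W = {(A, B, f). graph_map A B f \<and>
         (\<forall>T. undirected_subgraph T A \<and> T \<cong>\<^sub>G stiff_subgraph A \<longrightarrow>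
            graph_isomorphism T (image_graph f T) (restrict f (pverts T)) \<and>
            image_graph f T \<cong>\<^sub>G stiff_subgraph B)}"

definition two_out_of_six :: "'a graph_morphism set \<Rightarrow> bool" where
  "two_out_of_six M \<longleftrightarrow>
     (\<forall>A B C D f g h. graph_map A B f \<and> graph_map B C g \<and> graph_map C D h \<and>
        (A, C, compose (pverts A) g f) \<in> M \<and> (B, D, compose (pverts B) h g) \<in> M \<longrightarrow>
        (A, B, f) \<in> M \<and> (B, C, g) \<in> M \<and> (C, D, h) \<in> M \<and>
        (A, D, compose (pverts A) h (compose (pverts A) g f)) \<in> M)"

definition W_new :: "'a graph_morphism set" where
  "W_new = \<Inter> {M. M \<subseteq> graph_morphisms \<and> W \<subseteq> M \<and> two_out_of_six M}"

end

theory Submission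
  imports Defs
begin

text \<open>
  An inclusion of graphs lies in \<open>W\<close> as soon as its domain and codomain have isomorphic stiff
  subgraphs. Hence 2 out of 6 applies to every chain \<open>A \<subseteq> B \<subseteq> C \<subseteq> D\<close> in which the stiff
  subgraphs alternate, \<open>A\<^sub>s \<cong> C\<^sub>s\<close> and \<open>B\<^sub>s \<cong> D\<^sub>s\<close>. The graph of an equivalence relation folds down to
  one looped vertex per class, so it suffices to find equivalence relations with \<open>1, 2, 1, 2\<close>
  classes: the loop at \<open>0\<close>; add a loop at \<open>1\<close>; join \<open>0\<close> to \<open>1\<close>; add a loop at \<open>2\<close>.
\<close>

lemma arc_in_pverts:
  assumes "pair_pseudo_graph G" "(u, v) \<in> parcs G"
  shows "u \<in> pverts G \<and> v \<in> pverts G"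
proof -
  interpret pair_pseudo_graph G by fact
  show ?thesis using assms(2) by (meson in_arcsD1 in_arcsD2)
qed

lemma graph_isomorphic_trans:
  assumes "A \<cong>\<^sub>G B" "B \<cong>\<^sub>G C"
  shows "A \<cong>\<^sub>G C"
proof -
  obtain f g where f: "graph_isomorphism A B f" and g: "graph_isomorphism B C g"
    using assms unfolding graph_isomorphic_def by blast
  then have maps: "graph_map A B f" "graph_map B C g"
    and bij: "bij_betw f (pverts A) (pverts B)" "bij_betw g (pverts B) (pverts C)"
    and refl: "\<And>u v. \<lbrakk>u \<in> pverts A; v \<in> pverts A; (f u, f v) \<in> parcs B\<rbrakk> \<Longrightarrow> (u, v) \<in> parcs A"
      "\<And>u v. \<lbrakk>u \<in> pverts B; v \<in> pverts B; (g u, g v) \<in> parcs C\<rbrakk> \<Longrightarrow> (u, v) \<in> parcs B"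
    unfolding graph_isomorphism_def by simp_all
  let ?h = "compose (pverts A) g f"
  have vert: "f x \<in> pverts B" if "x \<in> pverts A" for x
    using bij(1) that by (rule bij_betwE[rule_format])
  have pg: "pair_pseudo_graph A" "pair_pseudo_graph C"
    and pres: "\<And>u v. (u, v) \<in> parcs A \<Longrightarrow> (f u, f v) \<in> parcs B"
      "\<And>u v. (u, v) \<in> parcs B \<Longrightarrow> (g u, g v) \<in> parcs C"
    using maps unfolding graph_map_def by simp_all
  have h: "bij_betw ?h (pverts A) (pverts C)"
    using bij by (rule bij_betw_compose)
  have "?h \<in> pverts A \<rightarrow>\<^sub>E pverts C"
    using bij_betwE[OF h] by (simp add: PiE_iff compose_def)
  moreover have "(?h u, ?h v) \<in> parcs C" if "(u, v) \<in> parcs A" for u v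
    using arc_in_pverts[OF pg(1) that] pres that by (simp add: compose_eq)
  moreover have "(u, v) \<in> parcs A"
    if "u \<in> pverts A" "v \<in> pverts A" "(?h u, ?h v) \<in> parcs C" for u v
    using that vert by (intro refl) (simp_all add: compose_eq)
  ultimately have "graph_isomorphism A C ?h"
    using pg h unfolding graph_isomorphism_def graph_map_def by simp
  then show ?thesis unfolding graph_isomorphic_def by blast
qed

definition class_graph :: "('a \<Rightarrow> 'b) \<Rightarrow> 'a set \<Rightarrow> 'a pair_pre_digraph" where
  "class_graph c V = \<lparr>pverts = V, parcs = {(u, v). u \<in> V \<and> v \<in> V \<and> c u = c v}\<rparr>"

lemma pverts_class_graph [simp]: "pverts (class_graph c V) = V"
  by (simp add: class_graph_def)

lemma parcs_class_graph [simp]: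
  "(u, v) \<in> parcs (class_graph c V) \<longleftrightarrow> u \<in> V \<and> v \<in> V \<and> c u = c v"
  by (simp add: class_graph_def)

lemma pair_pseudo_graph_class_graph:
  assumes "finite V"
  shows "pair_pseudo_graph (class_graph c V)"
proof
  have "parcs (class_graph c V) \<subseteq> V \<times> V" by auto
  then show "finite (parcs (class_graph c V))" using assms by (meson finite_SigmaI finite_subset)
  show "symmetric (with_proj (class_graph c V))"
    by (auto simp: symmetric_def arcs_ends_def arc_to_ends_def sym_def)
qed (use assms in \<open>simp_all add: class_graph_def split: prod.splits\<close>)

text \<open>The neighbourhood of a vertex is its own class. Every vertex is looped, so inclusion of
  neighbourhoods puts \<open>v\<close> itself into the class of \<open>v'\<close>.\<close>

lemma folds_to_class_graph:
  "folds_to (class_graph c V) v v' \<longleftrightarrow> v \<in> V \<and> v' \<in> V \<and> v' \<noteq> v \<and> c v = c v'"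
  by (auto simp: folds_to_def neighbours_def)

lemma stiff_class_graph: "stiff (class_graph c V) \<longleftrightarrow> inj_on c V"
  by (auto simp: stiff_def folds_to_class_graph inj_on_def)

text \<open>The vertex folded away leaves behind another one with its label, so no class is
  lost.\<close>

lemma fold_step_class_graph:
  assumes "fold_step (class_graph c V) H"
  shows "\<exists>S\<subseteq>V. H = class_graph c S \<and> c ` S = c ` V"
proof -
  obtain v v' where v: "v \<in> V" "v' \<in> V" "v' \<noteq> v" "c v = c v'"
      and H: "H = delete_vertex (class_graph c V) v"
    using assms by (auto simp: fold_step_def folds_to_class_graph)
  have "H = class_graph c (V - {v})"
    unfolding H delete_vertex_def class_graph_def by auto
  moreover have "c ` (V - {v}) = c ` V" using v by (auto simp: image_iff)
  ultimately show ?thesis by blast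
qed

lemma fold_steps_class_graph:
  assumes "fold_step\<^sup>*\<^sup>* (class_graph c V) H"
  shows "\<exists>S\<subseteq>V. H = class_graph c S \<and> c ` S = c ` V"
  using assms
proof (induction rule: rtranclp_induct)
  case base
  show ?case by (intro exI[of _ V]) simp
next
  case (step H K)
  then obtain S where "S \<subseteq> V" "H = class_graph c S" "c ` S = c ` V" by blast
  with fold_step_class_graph[of c S K] step.hyps show ?case by (metis order_trans)
qed

text \<open>Folding goes on until one vertex per class is left. Which representatives survive
  depends on the choice made in \<open>stiff_subgraph\<close>, but their number does not.\<close>

lemma stiff_subgraph_class_graph:
  assumes "finite V"
  obtains S where "S \<subseteq> V" "stiff_subgraph (class_graph c V) = class_graph c S"
    "inj_on c S" "card S = card (c ` V)"
proof -
  let ?H = "stiff_subgraph (class_graph c V)"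
  have H: "fold_step\<^sup>*\<^sup>* (class_graph c V) ?H" "stiff ?H"
    using stiff_subgraph_of_stiff_subgraph[OF pair_pseudo_graph_class_graph[OF assms, of c]]
    by (simp_all add: stiff_subgraph_of_def)
  obtain S where S: "S \<subseteq> V" "?H = class_graph c S" "c ` S = c ` V"
    using fold_steps_class_graph[OF H(1)] by blast
  have inj: "inj_on c S" using H(2) by (simp add: S(2) stiff_class_graph)
  show thesis using that[OF S(1,2) inj] card_image[OF inj] S(3) by simp
qed

text \<open>With injective labels the only arcs are the loops, one at each vertex, so every
  bijection of the vertex sets is an isomorphism.\<close>

lemma inj_class_graphs_isomorphic:
  assumes "finite S" "finite T" "inj_on c S" "inj_on d T" "card S = card T"
  shows "class_graph c S \<cong>\<^sub>G class_graph d T"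
proof -
  obtain h where h: "bij_betw h S T" using assms finite_same_card_bij by blast
  \<comment> \<open>Graph maps have to be extensional, hence the restriction.\<close>
  then have "bij_betw (restrict h S) S T" by (simp cong: bij_betw_cong)
  then have "graph_isomorphism (class_graph c S) (class_graph d T) (restrict h S)"
    using assms h
    by (auto simp: graph_isomorphism_def graph_map_def pair_pseudo_graph_class_graph
        inj_on_eq_iff bij_betw_def)
  then show ?thesis unfolding graph_isomorphic_def by blast
qed

lemma stiff_subgraph_class_graph_isomorphic_iff:
  assumes "finite V" "finite V'"
  shows "stiff_subgraph (class_graph c V) \<cong>\<^sub>G stiff_subgraph (class_graph d V')
    \<longleftrightarrow> card (c ` V) = card (d ` V')"
proof -
  obtain S where S: "S \<subseteq> V" "stiff_subgraph (class_graph c V) = class_graph c S"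
      "inj_on c S" "card S = card (c ` V)"
    using stiff_subgraph_class_graph[OF assms(1)] by blast
  obtain T where T: "T \<subseteq> V'" "stiff_subgraph (class_graph d V') = class_graph d T"
      "inj_on d T" "card T = card (d ` V')"
    using stiff_subgraph_class_graph[OF assms(2)] by blast
  have "card S = card T" if "class_graph c S \<cong>\<^sub>G class_graph d T"
    using that by (auto simp: graph_isomorphic_def graph_isomorphism_def dest: bij_betw_same_card)
  moreover have "finite S" "finite T" using S T assms finite_subset by blast+
  ultimately show ?thesis using S T inj_class_graphs_isomorphic[of S T c d] by auto
qed

text \<open>An inclusion maps each subgraph \<open>T\<close> identically onto itself, so all that
  remains of the condition is the chain from \<open>T\<close> through the stiff subgraph of
  \<open>A\<close> to that of \<open>B\<close>.\<close>

lemma inclusion_in_W: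
  assumes "graph_map A B (restrict id (pverts A))"
    and iso: "stiff_subgraph A \<cong>\<^sub>G stiff_subgraph B"
  shows "(A, B, restrict id (pverts A)) \<in> W"
proof -
  let ?i = "restrict id (pverts A)"
  have "graph_isomorphism T (image_graph ?i T) (restrict ?i (pverts T)) \<and>
      image_graph ?i T \<cong>\<^sub>G stiff_subgraph B"
    if T: "undirected_subgraph T A" "T \<cong>\<^sub>G stiff_subgraph A" for T
  proof -
    have sub: "pverts T \<subseteq> pverts A" and pg: "pair_pseudo_graph T"
      using T(1) by (auto simp: undirected_subgraph_def subgraph_def)
    note arcs = arc_in_pverts[OF pg]
    have "?i ` pverts T = pverts T" using sub by force
    \<comment> \<open>Both ends of an arc of \<open>T\<close> are vertices of \<open>A\<close>,
      where \<open>?i\<close> is the identity.\<close>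
    moreover have "map_prod ?i ?i ` parcs T = id ` parcs T"
      by (rule image_cong) (use sub in \<open>auto simp: subset_iff dest!: arcs\<close>)
    ultimately have im: "image_graph ?i T = T" by (simp add: image_graph_def)
    have res: "restrict ?i (pverts T) = restrict id (pverts T)"
      using sub by (auto simp: restrict_def fun_eq_iff)
    have "bij_betw (restrict id (pverts T)) (pverts T) (pverts T)"
      by (simp add: bij_betw_def inj_on_def)
    then have "graph_isomorphism T T (restrict id (pverts T))"
      using pg arcs by (auto simp: graph_isomorphism_def graph_map_def)
    then show ?thesis using im res T(2) iso graph_isomorphic_trans by metis
  qed
  with assms(1) show ?thesis by (simp add: W_def)
qed

theorem theorem4p5:
  shows "\<exists>(A :: nat pair_pre_digraph) (B :: nat pair_pre_digraph) (f :: nat \<Rightarrow> nat).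
           (A, B, f) \<in> W_new \<and> \<not> (stiff_subgraph A \<cong>\<^sub>G stiff_subgraph B)"
proof -
  define A :: "nat pair_pre_digraph" where "A = class_graph id {0}"
  define B :: "nat pair_pre_digraph" where "B = class_graph id {0, 1}"
  define C :: "nat pair_pre_digraph" where "C = class_graph (\<lambda>_. 0 :: nat) {0, 1}"
  \<comment> \<open>Halving gives 0 and 1 the same label, so they stay joined as in
    \<open>C\<close>, and gives 2 a label of its own.\<close>
  define D :: "nat pair_pre_digraph" where "D = class_graph (\<lambda>x. x div 2) {0, 1, 2}"
  let ?i = "\<lambda>G :: nat pair_pre_digraph. restrict id (pverts G)"
  note defs = A_def B_def C_def D_def
  have maps: "graph_map A B (?i A)" "graph_map B C (?i B)" "graph_map C D (?i C)"
      "graph_map A C (?i A)" "graph_map B D (?i B)"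
    by (auto simp: defs graph_map_def pair_pseudo_graph_class_graph)
  \<comment> \<open>Composing two of these inclusions yields literally the extensional inclusion of
    the smallest graph, as the hypotheses of 2 out of 6 require.\<close>
  have comp: "compose (pverts A) (?i B) (?i A) = ?i A" "compose (pverts B) (?i C) (?i B) = ?i B"
    by (auto simp: defs compose_def fun_eq_iff)
  have "(A, C, ?i A) \<in> W"
    using maps by (intro inclusion_in_W)
      (simp_all add: A_def C_def stiff_subgraph_class_graph_isomorphic_iff)
  moreover have "(B, D, ?i B) \<in> W"
    using maps by (intro inclusion_in_W)
      (simp_all add: B_def D_def stiff_subgraph_class_graph_isomorphic_iff)
  \<comment> \<open>The first of the three maps in 2 out of 6 is the one wanted; it lies in every
    class over which \<open>W_new\<close> intersects.\<close>
  ultimately have "(A, B, ?i A) \<in> M" if M: "W \<subseteq> M" "two_out_of_six M" for M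
    using M(1) maps comp
      M(2)[unfolded two_out_of_six_def, rule_format, of A B "?i A" C "?i B" D "?i C"]
    by auto
  then have "(A, B, ?i A) \<in> W_new" by (auto simp: W_new_def)
  \<comment> \<open>One class against two.\<close>
  moreover have "\<not> (stiff_subgraph A \<cong>\<^sub>G stiff_subgraph B)"
    by (simp add: A_def B_def stiff_subgraph_class_graph_isomorphic_iff)
  ultimately show ?thesis by blast
qed

end
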